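(* Let $\Gamma$ be a random edge-labelled graph on $n$ vertices with label probabilities $p_m=p_m(n)$. If $np_3\to\infty$ as $n\to\infty$, then $W_\Gamma$ is asymptotically almost surely not of FC-type.
   Context: Random edge-labelled graph: for each $n$, nonnegative numbers $p_m(n)$ ($m=2,3,4,\dots$) are given with $\sum_{m=2}^\infty p_m(n)\le 1$. On a vertex set of size $n$, independently for each pair of vertices, the pair is joined by an edge labelled $m$ with probability $p_m(n)$ for each integer $m\ge2$, and is not joined by an edge with the remaining probability. "Asymptotically almost surely" means with probability tending to $1$ as $n\to\infty$. Coxeter group: if $\Gamma$ has vertices $v_1,\dots,v_n$ and the edge between $v_i$ and $v_j$ (if present) has label $m_{i,j}$, then $W_\Gamma=\langle v_1,\dots,v_n\mid v_i^2,\ (v_iv_j)^{m_{i,j}}\rangle$, with the second type of relator only for adjacent pairs. $W_\Gamma$ is of FC-type if the vertex set of every clique (complete subgraph) in $\Gamma$ generates a finite subgroup of $W_\Gamma$. *)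

theory Defs
  imports "HOL-Probability.Probability" "HOL-Algebra.Generated_Groups" "HOL-Library.Ramsey"
begin

section \<open>Group presentations\<close>

text \<open>
  A letter \<open>(x, True)\<close> stands for the generator \<open>x\<close> and \<open>(x, False)\<close> for its formal inverse.
  The group with generators \<open>S\<close> and relators \<open>R\<close> consists of the words over \<open>S\<close> modulo the least
  congruence that cancels adjacent mutually inverse letters and identifies each relator
  with the empty word.
\<close>

type_synonym 'a word = "('a \<times> bool) list"

definition words :: "'a set \<Rightarrow> 'a word set" where
  "words S = lists (S \<times> UNIV)"

inductive_set pres_rel :: "'a set \<Rightarrow> 'a word set \<Rightarrow> ('a word \<times> 'a word) set"
  for S :: "'a set" and R :: "'a word set"
where
  refl: "u \<in> words S \<Longrightarrow> (u, u) \<in> pres_rel S R"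
| sym: "(u, v) \<in> pres_rel S R \<Longrightarrow> (v, u) \<in> pres_rel S R"
| trans: "(u, v) \<in> pres_rel S R \<Longrightarrow> (v, w) \<in> pres_rel S R \<Longrightarrow> (u, w) \<in> pres_rel S R"
| cancel: "u \<in> words S \<Longrightarrow> v \<in> words S \<Longrightarrow> x \<in> S
           \<Longrightarrow> (u @ [(x, b), (x, \<not> b)] @ v, u @ v) \<in> pres_rel S R"
| relator: "u \<in> words S \<Longrightarrow> v \<in> words S \<Longrightarrow> r \<in> R \<Longrightarrow> (u @ r @ v, u @ v) \<in> pres_rel S R"

definition presented_group :: "'a set \<Rightarrow> 'a word set \<Rightarrow> 'a word set monoid" where
  "presented_group S R =
     \<lparr>carrier = words S // pres_rel S R,
      mult = (\<lambda>A B. \<Union>a\<in>A. \<Union>b\<in>B. pres_rel S R `` {a @ b}),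
      one = pres_rel S R `` {[]}\<rparr>"

definition pres_gen :: "'a set \<Rightarrow> 'a word set \<Rightarrow> 'a \<Rightarrow> 'a word set" where
  "pres_gen S R x = pres_rel S R `` {[(x, True)]}"

lemma append_in_words [simp]: "u @ v \<in> words S \<longleftrightarrow> u \<in> words S \<and> v \<in> words S"
  by (simp add: words_def)

lemma Nil_in_words [simp]: "[] \<in> words S"
  by (simp add: words_def)

lemma pres_rel_words:
  assumes "R \<subseteq> words S" "(u, v) \<in> pres_rel S R"
  shows "u \<in> words S" "v \<in> words S"
proof -
  have "u \<in> words S \<and> v \<in> words S"
    using assms(2,1) by induction (auto simp: words_def)
  then show "u \<in> words S" "v \<in> words S" by auto
qed

lemma equiv_pres_rel: "R \<subseteq> words S \<Longrightarrow> equiv (words S) (pres_rel S R)"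
  by (rule equivI)
     (auto simp: refl_on_def sym_def trans_def dest: pres_rel_words intro: pres_rel.intros)

lemma pres_rel_append_right:
  assumes "(u, v) \<in> pres_rel S R" "w \<in> words S"
  shows "(u @ w, v @ w) \<in> pres_rel S R"
  using assms
proof induction
  case (cancel u v x b)
  then show ?case using pres_rel.cancel[of u S "v @ w" x b R] by simp
next
  case (relator u v r)
  then show ?case using pres_rel.relator[of u S "v @ w" r R] by simp
qed (auto intro: pres_rel.intros)

lemma pres_rel_append_left:
  assumes "(u, v) \<in> pres_rel S R" "w \<in> words S"
  shows "(w @ u, w @ v) \<in> pres_rel S R"
  using assms
proof induction
  case (cancel u v x b)
  then show ?case using pres_rel.cancel[of "w @ u" S v x b R] by simp
next
  case (relator u v r)
  then show ?case using pres_rel.relator[of "w @ u" S v r R] by simp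
qed (auto intro: pres_rel.intros)

lemma mult_presented_group:
  assumes R: "R \<subseteq> words S" and u: "u \<in> words S" and v: "v \<in> words S"
  shows "pres_rel S R `` {u} \<otimes>\<^bsub>presented_group S R\<^esub> pres_rel S R `` {v} = pres_rel S R `` {u @ v}"
proof -
  have "congruent2 (pres_rel S R) (pres_rel S R) (\<lambda>a b. pres_rel S R `` {a @ b})"
  proof (rule congruent2I[OF equiv_pres_rel[OF R] equiv_pres_rel[OF R]])
    show "pres_rel S R `` {y @ w} = pres_rel S R `` {z @ w}"
      if "w \<in> words S" "(y, z) \<in> pres_rel S R" for y z w
      by (rule equiv_class_eq[OF equiv_pres_rel[OF R]]) (rule pres_rel_append_right[OF that(2,1)])
    show "pres_rel S R `` {w @ y} = pres_rel S R `` {w @ z}"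
      if "w \<in> words S" "(y, z) \<in> pres_rel S R" for y z w
      by (rule equiv_class_eq[OF equiv_pres_rel[OF R]]) (rule pres_rel_append_left[OF that(2,1)])
  qed
  from UN_equiv_class2[OF equiv_pres_rel[OF R] equiv_pres_rel[OF R] this u v]
  show ?thesis by (simp add: presented_group_def)
qed

lemma group_presented_group:
  assumes R: "R \<subseteq> words S"
  shows "group (presented_group S R)"
proof -
  let ?G = "presented_group S R" and ?c = "\<lambda>u. pres_rel S R `` {u}"
  have carr: "carrier ?G = ?c ` words S"
    by (auto simp: presented_group_def quotient_def)
  have one: "\<one>\<^bsub>?G\<^esub> = ?c []" by (simp add: presented_group_def)
  have inv: "\<exists>v\<in>words S. (v @ u, []) \<in> pres_rel S R" if "u \<in> words S" for u
    using that
  proof (induction u)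
    case Nil
    show ?case by (rule bexI[of _ "[]"]) (auto intro: pres_rel.refl)
  next
    case (Cons l u)
    obtain x b where l: "l = (x, b)" by (cases l)
    from Cons have x: "x \<in> S" and u: "u \<in> words S" by (auto simp: words_def l)
    with Cons obtain v where v: "v \<in> words S" "(v @ u, []) \<in> pres_rel S R" by auto
    have "((v @ [(x, \<not> b)]) @ l # u, v @ u) \<in> pres_rel S R"
      using pres_rel.cancel[OF v(1) u x, of "\<not> b" R] by (simp add: l)
    with v(2) have "((v @ [(x, \<not> b)]) @ l # u, []) \<in> pres_rel S R"
      by (blast intro: pres_rel.trans)
    moreover have "v @ [(x, \<not> b)] \<in> words S" using v(1) x by (simp add: words_def)
    ultimately show ?case by blast
  qed
  show ?thesis
  proof (rule groupI)
    fix A assume "A \<in> carrier ?G"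
    then obtain u where u: "u \<in> words S" "A = ?c u" by (auto simp: carr)
    show "\<one>\<^bsub>?G\<^esub> \<otimes>\<^bsub>?G\<^esub> A = A"
      using mult_presented_group[OF R Nil_in_words u(1)] by (simp add: one u(2))
    obtain v where v: "v \<in> words S" "(v @ u, []) \<in> pres_rel S R" using inv[OF u(1)] by blast
    have "?c v \<otimes>\<^bsub>?G\<^esub> A = \<one>\<^bsub>?G\<^esub>"
      using mult_presented_group[OF R v(1) u(1)] equiv_class_eq[OF equiv_pres_rel[OF R] v(2)]
      by (simp add: one u(2))
    with v(1) show "\<exists>B\<in>carrier ?G. B \<otimes>\<^bsub>?G\<^esub> A = \<one>\<^bsub>?G\<^esub>" by (auto simp: carr)
  qed (auto simp: carr one mult_presented_group[OF R])
qed


section \<open>Edge-labelled graphs and their Coxeter groups\<close>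

text \<open>
  A labelling is indexed by unordered pairs: \<open>\<Gamma> {u, v} = Some m\<close> means that \<open>u\<close> and \<open>v\<close> are joined
  by an edge labelled \<open>m\<close>, and \<open>\<Gamma> {u, v} = None\<close> that they are not joined.
  Only values at two-element sets of vertices matter.
\<close>

type_synonym 'v labelled_graph = "'v set \<Rightarrow> nat option"

text \<open>
  For each adjacent pair both \<open>(u v)\<^sup>m\<close> and \<open>(v u)\<^sup>m\<close> are relators; these are
  consequences of each other, so no order on the vertices has to be chosen.
\<close>

definition coxeter_relators :: "'v set \<Rightarrow> 'v labelled_graph \<Rightarrow> 'v word set" where
  "coxeter_relators V \<Gamma> =
     {[(v, True), (v, True)] | v. v \<in> V} \<union>
     {concat (replicate m [(u, True), (v, True)]) | u v m.
        u \<in> V \<and> v \<in> V \<and> u \<noteq> v \<and> \<Gamma> {u, v} = Some m}"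

definition coxeter_group :: "'v set \<Rightarrow> 'v labelled_graph \<Rightarrow> 'v word set monoid" where
  "coxeter_group V \<Gamma> = presented_group V (coxeter_relators V \<Gamma>)"

definition coxeter_gen :: "'v set \<Rightarrow> 'v labelled_graph \<Rightarrow> 'v \<Rightarrow> 'v word set" where
  "coxeter_gen V \<Gamma> = pres_gen V (coxeter_relators V \<Gamma>)"

definition FC_type :: "'v set \<Rightarrow> 'v labelled_graph \<Rightarrow> bool" where
  "FC_type V \<Gamma> \<longleftrightarrow>
     (\<forall>C. C \<subseteq> V \<and> clique C {e. \<Gamma> e \<noteq> None} \<longrightarrow>
        finite (generate (coxeter_group V \<Gamma>) (coxeter_gen V \<Gamma> ` C)))"

lemma coxeter_relators_subset: "coxeter_relators V \<Gamma> \<subseteq> words V"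
  by (auto simp: coxeter_relators_def words_def split: if_splits)

lemma group_coxeter_group: "group (coxeter_group V \<Gamma>)"
  unfolding coxeter_group_def by (rule group_presented_group[OF coxeter_relators_subset])


section \<open>Random edge-labelled graphs\<close>

definition label_weights :: "(nat \<Rightarrow> real) \<Rightarrow> bool" where
  "label_weights q \<longleftrightarrow>
     (\<forall>m\<ge>2. 0 \<le> q m) \<and> q summable_on {2..} \<and> (\<Sum>\<^sub>\<infinity>m\<in>{2..}. q m) \<le> 1"

definition label_pmf :: "(nat \<Rightarrow> real) \<Rightarrow> nat option pmf" where
  "label_pmf q = embed_pmf (\<lambda>l. case l of
       None \<Rightarrow> 1 - (\<Sum>\<^sub>\<infinity>m\<in>{2..}. q m)
     | Some m \<Rightarrow> if 2 \<le> m then q m else 0)"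

definition random_labelled_graph :: "nat \<Rightarrow> (nat \<Rightarrow> real) \<Rightarrow> nat labelled_graph pmf" where
  "random_labelled_graph n q = Pi_pmf (nsets {..<n} 2) None (\<lambda>_. label_pmf q)"

lemma pmf_label_pmf:
  assumes q: "label_weights q"
  shows "pmf (label_pmf q) None = 1 - (\<Sum>\<^sub>\<infinity>m\<in>{2..}. q m)"
    and "pmf (label_pmf q) (Some m) = (if 2 \<le> m then q m else 0)"
proof -
  let ?s = "\<Sum>\<^sub>\<infinity>m\<in>{2..}. q m"
  let ?f = "\<lambda>l. case l of None \<Rightarrow> 1 - ?s | Some m \<Rightarrow> if 2 \<le> m then q m else (0::real)"
  let ?g = "\<lambda>m. if 2 \<le> m then q m else (0::real)"
  have nn: "0 \<le> ?f l" for l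
    using q by (auto simp: label_weights_def split: option.split)
  have "(q has_sum ?s) {2..}" using q by (auto simp: label_weights_def)
  then have "(?g has_sum ?s) UNIV"
    by (subst has_sum_cong_neutral[of "{2..}" UNIV q ?g]) auto
  then have sums: "?g sums ?s" by (rule has_sum_imp_sums)
  have 1: "(\<integral>\<^sup>+m. ennreal (?g m) \<partial>count_space UNIV) = ennreal ?s"
    using sums q by (subst nn_integral_count_space_nat)
      (auto intro!: suminf_ennreal_eq simp: label_weights_def)
  have "(\<integral>\<^sup>+l. ennreal (?f l) \<partial>count_space UNIV)
      = (\<integral>\<^sup>+l. ennreal (?f l) \<partial>count_space {None}) + (\<integral>\<^sup>+l. ennreal (?f l) \<partial>count_space (range Some))"
    by (subst (2 3) nn_integral_count_space_indicator, simp, simp, subst nn_integral_add[symmetric])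
       (auto intro!: nn_integral_cong simp: UNIV_option_conv split: split_indicator)
  also have "(\<integral>\<^sup>+l. ennreal (?f l) \<partial>count_space (range Some))
      = (\<integral>\<^sup>+m. ennreal (?g m) \<partial>count_space UNIV)"
    by (subst nn_integral_bij_count_space[symmetric, of Some UNIV])
       (auto simp: bij_betw_def)
  also have "(\<integral>\<^sup>+l. ennreal (?f l) \<partial>count_space {None}) = ennreal (1 - ?s)"
    by (simp add: nn_integral_count_space_finite)
  also have "ennreal (1 - ?s) + (\<integral>\<^sup>+m. ennreal (?g m) \<partial>count_space UNIV) = 1"
  proof -
    have "0 \<le> ?s" using q by (auto simp: label_weights_def intro!: infsum_nonneg)
    then show ?thesis using q by (simp add: 1 label_weights_def flip: ennreal_plus)
  qed
  finally have tot: "(\<integral>\<^sup>+l. ennreal (?f l) \<partial>count_space UNIV) = 1" .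
  show "pmf (label_pmf q) None = 1 - ?s"
    and "pmf (label_pmf q) (Some m) = (if 2 \<le> m then q m else 0)"
    unfolding label_pmf_def by (simp_all add: pmf_embed_pmf[OF nn tot])
qed

end

theory Submission
  imports Defs
begin

text \<open>
  A triangle all of whose labels are 3 is a clique that generates an infinite subgroup: its
  Coxeter group is the affine group \<open>\<langle>a, b, c\<rangle>\<close> of symmetries of the tiling of the plane by
  equilateral triangles, and this contains translations. When \<open>n p\<^sub>3 \<rightarrow> \<infinity>\<close>, such a triangle is
  present asymptotically almost surely, by the second moment method.

  The algebraic half has to show that \<open>a, b, c\<close> generate an infinite subgroup of \<open>W\<^sub>\<Gamma>\<close> itself,
  whatever the labels of the other edges are; \<open>W\<^sub>\<Gamma>\<close> need not retract onto the affine group.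
  The dual of Tits' geometric representation serves for this. Every generator \<open>u\<close> acts on
  functions on the vertices by \<open>f \<mapsto> f - 2 f(u) B(u, \<cdot>)\<close>, where \<open>B(u, v) = - cos (\<pi> / m)\<close> for an edge
  labelled \<open>m\<close>. The labels are almost surely at least 2 (\<open>random_graph_no_label_1\<close>), and then the
  relators act trivially (\<open>dual_reflections_braid\<close>), so equivalent words act equally (\<open>word_action_cong\<close>). The word \<open>a b a c\<close> acts on the values of \<open>f\<close> at
  \<open>(a, b, c)\<close> as the translation by \<open>K (-1, -1, 2)\<close> with \<open>K = f(a) + f(b) + f(c)\<close>, and \<open>K\<close> is
  invariant. Hence its powers are pairwise distinct in \<open>W\<^sub>\<Gamma>\<close>. Working with the dual
  avoids sums over vertices and lets the values at \<open>a, b, c\<close> evolve by themselves.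

  For the probabilistic half, let \<open>X\<close> count the triangles with all labels 3, put \<open>p = p\<^sub>3\<close>, and let
  \<open>N\<close> be the number of triples of vertices. Then \<open>E X = N p\<^sup>3\<close>. Triples with at most one common
  vertex share no edge and give independent events; a triple shares exactly one edge with at
  most \<open>3 n\<close> others, so \<open>Var X \<le> N p\<^sup>3 + 3 n N p\<^sup>5\<close>. By Chebyshev's inequality
  \<open>P(X = 0) \<le> Var X / (E X)\<^sup>2 \<le> 27 / (n p)\<^sup>3 + 81 / (n \<cdot> n p)\<close>
  (\<open>prob_no_triangle333_le\<close>), which tends to 0.
\<close>

section \<open>The dual geometric representation\<close>

text \<open>
  Non-adjacent pairs impose no relator, so any value would give a representation; \<open>-1\<close> is the
  usual choice, the limit of \<open>- cos (\<pi> / m)\<close>.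
\<close>

definition cox_form :: "'v labelled_graph \<Rightarrow> 'v \<Rightarrow> 'v \<Rightarrow> real" where
  "cox_form \<Gamma> u v =
     (if u = v then 1 else case \<Gamma> {u, v} of None \<Rightarrow> -1 | Some m \<Rightarrow> - cos (pi / m))"

definition dual_reflection :: "'v labelled_graph \<Rightarrow> 'v \<Rightarrow> ('v \<Rightarrow> real) \<Rightarrow> 'v \<Rightarrow> real" where
  "dual_reflection \<Gamma> u f = (\<lambda>w. f w - 2 * f u * cox_form \<Gamma> u w)"

text \<open>The sign of a letter can be ignored because the generators act by involutions.\<close>

definition word_action :: "'v labelled_graph \<Rightarrow> 'v word \<Rightarrow> ('v \<Rightarrow> real) \<Rightarrow> 'v \<Rightarrow> real" where
  "word_action \<Gamma> = foldr (\<lambda>l. dual_reflection \<Gamma> (fst l))"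

lemma cox_form_same [simp]: "cox_form \<Gamma> u u = 1"
  by (simp add: cox_form_def)

lemma dual_reflection_involution [simp]: "dual_reflection \<Gamma> u (dual_reflection \<Gamma> u f) = f"
  by (simp add: dual_reflection_def fun_eq_iff)

lemma word_action_append [simp]: "word_action \<Gamma> (v @ w) f = word_action \<Gamma> v (word_action \<Gamma> w f)"
  by (simp add: word_action_def)

lemma word_action_Nil [simp]: "word_action \<Gamma> [] f = f"
  by (simp add: word_action_def)

lemma word_action_Cons [simp]:
  "word_action \<Gamma> (l # w) f = dual_reflection \<Gamma> (fst l) (word_action \<Gamma> w f)"
  by (simp add: word_action_def)

lemma word_action_power:
  "word_action \<Gamma> (concat (replicate k w)) f = (word_action \<Gamma> w ^^ k) f"
  by (induction k) auto

text \<open>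
  The product of the two reflections changes \<open>f\<close> only by a combination of \<open>B(u, \<cdot>)\<close> and
  \<open>B(v, \<cdot>)\<close>, and such a combination is determined by its values at \<open>u\<close> and \<open>v\<close>, because
  \<open>B\<close> is nondegenerate on the plane of \<open>u\<close> and \<open>v\<close> when \<open>sin (\<pi> / m) \<noteq> 0\<close>. It is therefore
  enough to follow \<open>(f u, f v)\<close>. In a complex coordinate this pair undergoes a rotation by
  \<open>2 \<pi> / m\<close>, which has order \<open>m\<close>. The label 1 must be excluded, since it would identify
  \<open>u\<close> with \<open>v\<close> in the group but not in the representation.
\<close>

lemma dual_reflections_braid:
  assumes "u \<noteq> v" and m: "\<Gamma> {u, v} = Some m" "m \<noteq> 1"
  shows "((dual_reflection \<Gamma> u \<circ> dual_reflection \<Gamma> v) ^^ m) f = f"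
proof (cases "m = 0")
  case False
  with m have m2: "m \<ge> 2" by simp
  define \<theta> where "\<theta> = pi / m"
  have "0 < \<theta>" "\<theta> < pi"
    using m2 by (auto simp: \<theta>_def field_simps)
  then have sin: "sin \<theta> > 0" by (rule sin_gt_zero)
  have uv: "cox_form \<Gamma> u v = - cos \<theta>" "cox_form \<Gamma> v u = - cos \<theta>"
    using assms(1) m(1) by (auto simp: cox_form_def \<theta>_def insert_commute)
  \<comment> \<open>The roots of \<open>u\<close> and \<open>v\<close> are \<open>1\<close> and the conjugate of \<open>e\<close>, at angle \<open>\<pi> - \<theta>\<close>; the pair
     \<open>(f u, f v)\<close> consists of the inner products of \<open>z\<close> with these two vectors.\<close>
  define e where "e = - cis \<theta>"
  define z where "z = Complex (f u) ((f v + f u * cos \<theta>) / sin \<theta>)"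
  define g where "g k = ((dual_reflection \<Gamma> u \<circ> dual_reflection \<Gamma> v) ^^ k) f" for k
  have e2: "x * e * e = - (2 * cos \<theta>) *\<^sub>R (x * e) - x" for x
  proof -
    have "(sin \<theta>)\<^sup>2 = 1 - (cos \<theta>)\<^sup>2" by (simp add: sin_squared_eq)
    then have "e * e = - (2 * cos \<theta>) *\<^sub>R e - 1"
      by (simp add: e_def complex_eq_iff power2_eq_square)
    then have "x * (e * e) = x * (- (2 * cos \<theta>) *\<^sub>R e - 1)" by simp
    then show ?thesis by (simp add: mult.assoc right_diff_distrib)
  qed
  have plane: "g k u = Re (z * (e * e) ^ k) \<and> g k v = Re (z * (e * e) ^ k * e)" for k
  proof (induction k)
    case 0
    then show ?case using sin by (simp add: g_def z_def e_def)
  next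
    case (Suc k)
    define x where "x = z * (e * e) ^ k"
    have IH: "g k u = Re x" "g k v = Re (x * e)"
      using Suc by (simp_all add: x_def)
    have step: "g (Suc k) u = - (2 * cos \<theta> * g k v) - g k u"
      "g (Suc k) v = - (2 * cos \<theta> * (- (2 * cos \<theta> * g k v) - g k u)) - g k v"
      by (simp_all add: g_def dual_reflection_def uv algebra_simps)
    have u: "Re (x * e * e) = - (2 * cos \<theta> * Re (x * e)) - Re x"
      by (subst e2) simp
    have v: "Re (x * e * e * e) = - (2 * cos \<theta> * Re (x * e * e)) - Re (x * e)"
      by (subst e2) simp
    have "z * (e * e) ^ Suc k = x * e * e"
      by (simp add: x_def mult_ac)
    then show ?case
      unfolding step IH by (simp only: u v)
  qed
  have span: "\<exists>r s. g k = (\<lambda>w. f w + r * cox_form \<Gamma> u w + s * cox_form \<Gamma> v w)" for k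
  proof (induction k)
    case 0
    show ?case by (rule exI[of _ 0], rule exI[of _ 0]) (simp add: g_def)
  next
    case (Suc k)
    then obtain r s where *: "g k = (\<lambda>w. f w + r * cox_form \<Gamma> u w + s * cox_form \<Gamma> v w)"
      by blast
    have "g (Suc k) = (\<lambda>w. f w + (r - 2 * dual_reflection \<Gamma> v (g k) u) * cox_form \<Gamma> u w
        + (s - 2 * g k v) * cox_form \<Gamma> v w)"
      by (simp add: g_def dual_reflection_def * [unfolded g_def] algebra_simps)
    then show ?case by blast
  qed
  have "e * e = cis (2 * \<theta>)"
    by (simp add: e_def cis_mult)
  then have "(e * e) ^ m = cis (m * (2 * \<theta>))"
    by (simp only: Complex.DeMoivre)
  also have "m * (2 * \<theta>) = 2 * pi"
    using m2 by (simp add: \<theta>_def)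
  finally have "(e * e) ^ m = 1" by simp
  with plane[of m] plane[of 0] have same: "g m u = f u" "g m v = f v"
    by (simp_all add: g_def)
  obtain r s where g: "g m = (\<lambda>w. f w + r * cox_form \<Gamma> u w + s * cox_form \<Gamma> v w)"
    using span by blast
  have *: "r = s * cos \<theta>" "s = r * cos \<theta>"
    using same by (simp_all add: g uv)
  have "r * (sin \<theta>)\<^sup>2 = r - (r * cos \<theta>) * cos \<theta>"
    unfolding sin_squared_eq by (simp add: power2_eq_square algebra_simps)
  also have "\<dots> = 0"
    by (simp flip: *)
  finally have "r * (sin \<theta>)\<^sup>2 = 0" .
  with sin * have "r = 0" "s = 0" by auto
  then show ?thesis using g by (simp add: g_def)
qed simp

text \<open>So the action of words descends to a representation of \<open>W\<^sub>\<Gamma>\<close>.\<close>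

lemma word_action_cong:
  assumes no1: "\<And>u v. u \<in> V \<Longrightarrow> v \<in> V \<Longrightarrow> u \<noteq> v \<Longrightarrow> \<Gamma> {u, v} \<noteq> Some 1"
    and "(w, w') \<in> pres_rel V (coxeter_relators V \<Gamma>)"
  shows "word_action \<Gamma> w = word_action \<Gamma> w'"
  using assms(2)
proof induction
  case (cancel u v x b)
  then show ?case by (simp add: fun_eq_iff)
next
  case (relator u v r)
  have *: "word_action \<Gamma> r f = f" for f
    using relator(3) unfolding coxeter_relators_def
  proof (elim UnE CollectE exE conjE)
    fix x y m
    assume "x \<in> V" "y \<in> V" "x \<noteq> y" "\<Gamma> {x, y} = Some m"
      and r: "r = concat (replicate m [(x, True), (y, True)])"
    moreover from this no1 have "m \<noteq> 1" by auto
    ultimately have "((dual_reflection \<Gamma> x \<circ> dual_reflection \<Gamma> y) ^^ m) f = f"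
      by (intro dual_reflections_braid)
    moreover have "word_action \<Gamma> [(x, True), (y, True)] = dual_reflection \<Gamma> x \<circ> dual_reflection \<Gamma> y"
      by (simp add: fun_eq_iff)
    ultimately show ?thesis by (simp add: r word_action_power)
  qed simp
  show ?case by (rule ext) (simp add: *)
qed simp_all

section \<open>Triangles with all labels equal to 3\<close>

lemma word_class_in_generate:
  assumes "C \<subseteq> V" and "w \<in> lists ((\<lambda>v. (v, True)) ` C)"
  shows "pres_rel V (coxeter_relators V \<Gamma>) `` {w}
    \<in> generate (coxeter_group V \<Gamma>) (coxeter_gen V \<Gamma> ` C)"
  using assms(2)
proof induction
  case Nil
  show ?case
    using generate.one[of "coxeter_group V \<Gamma>"]
    by (simp add: coxeter_group_def presented_group_def)
next
  case (Cons l w)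
  then obtain v where v: "v \<in> C" "l = (v, True)" by auto
  have "coxeter_gen V \<Gamma> v \<otimes>\<^bsub>coxeter_group V \<Gamma>\<^esub> pres_rel V (coxeter_relators V \<Gamma>) `` {w}
      = pres_rel V (coxeter_relators V \<Gamma>) `` {[l] @ w}"
    unfolding coxeter_group_def coxeter_gen_def pres_gen_def v(2)
    using v assms(1) Cons(2)
    by (intro mult_presented_group[OF coxeter_relators_subset]) (auto simp: words_def)
  moreover have "coxeter_gen V \<Gamma> v \<otimes>\<^bsub>coxeter_group V \<Gamma>\<^esub> pres_rel V (coxeter_relators V \<Gamma>) `` {w}
      \<in> generate (coxeter_group V \<Gamma>) (coxeter_gen V \<Gamma> ` C)"
    using v(1) by (intro generate.eng[OF generate.incl Cons.IH]) simp
  ultimately show ?case by simp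
qed

text \<open>
  In the affine group, \<open>a b a\<close> is the reflection in the sum of the roots of \<open>a\<close> and \<open>b\<close>, whose
  mirrors are parallel to those of \<open>c\<close>; so \<open>a b a c\<close> is a translation and has infinite order.
\<close>

lemma generate_infinite_of_333_triangle:
  assumes no1: "\<And>u v. u \<in> V \<Longrightarrow> v \<in> V \<Longrightarrow> u \<noteq> v \<Longrightarrow> \<Gamma> {u, v} \<noteq> Some 1"
    and V: "{a, b, c} \<subseteq> V" and dist: "a \<noteq> b" "a \<noteq> c" "b \<noteq> c"
    and lab: "\<Gamma> {a, b} = Some 3" "\<Gamma> {a, c} = Some 3" "\<Gamma> {b, c} = Some 3"
  shows "infinite (generate (coxeter_group V \<Gamma>) (coxeter_gen V \<Gamma> ` {a, b, c}))"
proof -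
  let ?R = "pres_rel V (coxeter_relators V \<Gamma>)"
  define t :: "'a word" where "t = [(a, True), (b, True), (a, True), (c, True)]"
  define w where "w k = concat (replicate k t)" for k
  \<comment> \<open>The translation vector is proportional to \<open>f a + f b + f c\<close>, so this sum must not vanish.\<close>
  define f :: "'a \<Rightarrow> real" where "f = (\<lambda>v. if v = c then 1 else 0)"
  have form: "cox_form \<Gamma> a b = -1/2" "cox_form \<Gamma> b a = -1/2" "cox_form \<Gamma> a c = -1/2"
    "cox_form \<Gamma> c a = -1/2" "cox_form \<Gamma> b c = -1/2" "cox_form \<Gamma> c b = -1/2"
    using dist lab by (auto simp: cox_form_def insert_commute cos_60)
  have "word_action \<Gamma> (w k) f a = - real k \<and> word_action \<Gamma> (w k) f b = - real k
      \<and> word_action \<Gamma> (w k) f c = 1 + 2 * real k" for k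
  proof (induction k)
    case 0
    then show ?case using dist by (simp add: w_def f_def)
  next
    case (Suc k)
    then show ?case
      by (simp add: w_def t_def dual_reflection_def form field_simps)
  qed
  then have inj: "i = j" if "word_action \<Gamma> (w i) = word_action \<Gamma> (w j)" for i j
    using that by (metis of_nat_eq_iff neg_equal_iff_equal)
  have w: "w k \<in> lists ((\<lambda>v. (v, True)) ` {a, b, c})" for k
    by (induction k) (auto simp: w_def t_def)
  have "inj (\<lambda>k. ?R `` {w k})"
  proof (rule injI)
    fix i j
    assume "?R `` {w i} = ?R `` {w j}"
    moreover have "w j \<in> words V"
      using w[of j] V by (auto simp: words_def lists_eq_set)
    ultimately have "(w i, w j) \<in> ?R"
      using pres_rel.refl by fastforce
    from word_action_cong[OF no1 this] show "i = j"
      by (rule inj)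
  qed
  moreover have "range (\<lambda>k. ?R `` {w k}) \<subseteq> generate (coxeter_group V \<Gamma>) (coxeter_gen V \<Gamma> ` {a, b, c})"
    using word_class_in_generate[OF V w] by blast
  ultimately show ?thesis
    using finite_subset range_inj_infinite by blast
qed

definition triangle333 :: "'v set \<Rightarrow> 'v labelled_graph set" where
  "triangle333 T = {\<Gamma>. \<forall>e\<in>nsets T 2. \<Gamma> e = Some 3}"

lemma not_FC_type_of_triangle333:
  assumes no1: "\<And>e. e \<in> nsets V 2 \<Longrightarrow> \<Gamma> e \<noteq> Some 1"
    and T: "T \<in> nsets V 3" "\<Gamma> \<in> triangle333 T"
  shows "\<not> FC_type V \<Gamma>"
proof -
  from T(1) obtain a b c where T_eq: "T = {a, b, c}" and dist: "a \<noteq> b" "a \<noteq> c" "b \<noteq> c"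
    and V: "{a, b, c} \<subseteq> V"
    by (auto simp: nsets_3_eq)
  have lab: "\<Gamma> {x, y} = Some 3" if "x \<in> {a, b, c}" "y \<in> {a, b, c}" "x \<noteq> y" for x y
    using T(2) that unfolding triangle333_def T_eq by auto
  have "infinite (generate (coxeter_group V \<Gamma>) (coxeter_gen V \<Gamma> ` {a, b, c}))"
    using no1 dist lab by (intro generate_infinite_of_333_triangle V) auto
  moreover have "clique {a, b, c} {e. \<Gamma> e \<noteq> None}"
    using lab by (simp add: clique_def)
  ultimately show ?thesis
    unfolding FC_type_def using V by blast
qed

section \<open>The second moment method\<close>

text \<open>
  This is Chebyshev's inequality for the number \<open>X\<close> of events that occur: if none occurs, then
  \<open>X\<close> deviates from its mean by the whole mean. The variance of \<open>X\<close> is the sum of the covariances.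
\<close>

lemma (in prob_space) prob_none_le_second_moment:
  fixes A :: "'i \<Rightarrow> 'a set"
  assumes I: "finite I" and A: "\<And>i. i \<in> I \<Longrightarrow> A i \<in> events"
    and pos: "(\<Sum>i\<in>I. prob (A i)) > 0"
  shows "prob (space M - (\<Union>i\<in>I. A i))
    \<le> (\<Sum>i\<in>I. \<Sum>j\<in>I. prob (A i \<inter> A j) - prob (A i) * prob (A j)) / (\<Sum>i\<in>I. prob (A i))\<^sup>2"
proof -
  define X :: "'a \<Rightarrow> real" where "X = (\<lambda>x. \<Sum>i\<in>I. indicator (A i) x)"
  define \<mu> where "\<mu> = (\<Sum>i\<in>I. prob (A i))"
  have X2: "(X x)\<^sup>2 = (\<Sum>i\<in>I. \<Sum>j\<in>I. indicator (A i \<inter> A j) x)" for x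
    by (simp add: X_def power2_eq_square sum_product indicator_inter_arith)
  have int1: "integrable M (indicator (A i) :: 'a \<Rightarrow> real)" if "i \<in> I" for i
    using A[OF that] by (simp add: emeasure_eq_measure)
  have int2: "integrable M (indicator (A i \<inter> A j) :: 'a \<Rightarrow> real)" if "i \<in> I" "j \<in> I" for i j
    using A that by (simp add: emeasure_eq_measure sets.Int)
  have intX: "integrable M X" unfolding X_def by (intro Bochner_Integration.integrable_sum int1)
  have intX2: "integrable M (\<lambda>x. (X x)\<^sup>2)"
    unfolding X2 by (intro Bochner_Integration.integrable_sum int2)
  have EX: "expectation X = \<mu>"
    unfolding X_def \<mu>_def using int1 A by (subst Bochner_Integration.integral_sum) simp_all
  have EX2: "expectation (\<lambda>x. (X x)\<^sup>2) = (\<Sum>i\<in>I. \<Sum>j\<in>I. prob (A i \<inter> A j))"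
    unfolding X2 using int2 A
    by (simp add: Bochner_Integration.integral_sum sets.Int cong: sum.cong)
  have "prob (space M - (\<Union>i\<in>I. A i)) \<le> prob {x \<in> space M. \<mu> \<le> \<bar>X x - expectation X\<bar>}"
  proof (rule finite_measure_mono)
    show "{x \<in> space M. \<mu> \<le> \<bar>X x - expectation X\<bar>} \<in> events"
      using borel_measurable_integrable[OF intX] by measurable
    show "space M - (\<Union>i\<in>I. A i) \<subseteq> {x \<in> space M. \<mu> \<le> \<bar>X x - expectation X\<bar>}"
    proof
      fix x assume "x \<in> space M - (\<Union>i\<in>I. A i)"
      moreover from this have "X x = 0" by (simp add: X_def)
      ultimately show "x \<in> {x \<in> space M. \<mu> \<le> \<bar>X x - expectation X\<bar>}" by (simp add: EX)
    qed
  qed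
  also have "\<dots> \<le> variance X / \<mu>\<^sup>2"
    using Chebyshev_inequality[OF borel_measurable_integrable[OF intX] intX2] pos
    by (simp add: \<mu>_def)
  also have "variance X = (\<Sum>i\<in>I. \<Sum>j\<in>I. prob (A i \<inter> A j) - prob (A i) * prob (A j))"
    by (rule HOL.trans[OF variance_eq[OF intX intX2]])
       (simp only: EX EX2, simp add: \<mu>_def power2_eq_square sum_product sum_subtractf)
  finally show ?thesis by (simp add: \<mu>_def)
qed

section \<open>Counting triangles in the random graph\<close>

lemma card_nsets_choose: "finite A \<Longrightarrow> card (nsets A k) = card A choose k"
proof -
  assume A: "finite A"
  then have "nsets A k = {B. B \<subseteq> A \<and> card B = k}"
    by (auto simp: nsets_def intro: finite_subset)
  with A show ?thesis by (simp add: n_subsets)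
qed

lemma nsets_Int: "nsets (A \<inter> B) k = nsets A k \<inter> nsets B k"
  by (auto simp: nsets_def)

lemma prob_edges_all_3:
  assumes q: "label_weights q" and E: "E \<subseteq> nsets {..<n} 2"
  shows "measure_pmf.prob (random_labelled_graph n q) {\<Gamma>. \<forall>e\<in>E. \<Gamma> e = Some 3} = q 3 ^ card E"
proof -
  have fin: "finite (nsets {..<n} 2)" by (simp add: finite_imp_finite_nsets)
  have "{\<Gamma>. \<forall>e\<in>E. \<Gamma> e = Some 3} =
      Pi (nsets {..<n} 2) (\<lambda>e. if e \<in> E then {Some 3} else (UNIV :: nat option set))"
    using E by (auto simp: Pi_def split: if_splits)
  then have "measure_pmf.prob (random_labelled_graph n q) {\<Gamma>. \<forall>e\<in>E. \<Gamma> e = Some 3} =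
      (\<Prod>e\<in>nsets {..<n} 2. if e \<in> E then q 3 else 1)"
    unfolding random_labelled_graph_def using fin
    by (simp add: measure_Pi_pmf_Pi if_distrib measure_pmf_single pmf_label_pmf(2)[OF q] cong: if_cong)
  also have "\<dots> = q 3 ^ card E"
    using fin E by (simp add: prod.If_cases Int_absorb1)
  finally show ?thesis .
qed

lemma random_graph_no_label_1:
  assumes q: "label_weights q" and \<Gamma>: "\<Gamma> \<in> set_pmf (random_labelled_graph n q)"
    and e: "e \<in> nsets {..<n} 2"
  shows "\<Gamma> e \<noteq> Some 1"
proof -
  have "finite (nsets {..<n} 2)" by (simp add: finite_imp_finite_nsets)
  with \<Gamma> e have "\<Gamma> e \<in> set_pmf (label_pmf q)"
    by (auto simp: random_labelled_graph_def set_Pi_pmf PiE_dflt_def)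
  moreover have "Some 1 \<notin> set_pmf (label_pmf q)"
    using pmf_label_pmf(2)[OF q, of 1] by (simp add: set_pmf_eq)
  ultimately show ?thesis by auto
qed

text \<open>
  Two triples with at most one common vertex have no common edge, so their events are
  independent. Two common vertices mean one common edge, hence 5 edges in the union.
\<close>

lemma covariance_triangle333:
  assumes q: "label_weights q" and S: "S \<in> nsets {..<n} 3" and T: "T \<in> nsets {..<n} 3"
  defines "P \<equiv> measure_pmf.prob (random_labelled_graph n q)"
  shows "P (triangle333 S \<inter> triangle333 T) - P (triangle333 S) * P (triangle333 T)
    \<le> (if S = T then q 3 ^ 3 else 0) + (if card (S \<inter> T) = 2 then q 3 ^ 5 else 0)"
proof -
  have nonneg: "0 \<le> q 3" using q by (simp add: label_weights_def)
  have fin: "finite S" "finite T" and card: "card S = 3" "card T = 3"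
    and sub: "S \<subseteq> {..<n}" "T \<subseteq> {..<n}"
    using S T by (auto simp: nsets_def)
  have sub2: "nsets S 2 \<subseteq> nsets {..<n} 2" "nsets T 2 \<subseteq> nsets {..<n} 2"
    using sub by (auto intro: nsets_mono[THEN subsetD])
  have c3: "card (nsets S 2) = 3" "card (nsets T 2) = 3"
    using fin card by (simp_all add: card_nsets_choose choose_two)
  have PS: "P (triangle333 S) = q 3 ^ 3" "P (triangle333 T) = q 3 ^ 3"
    unfolding P_def triangle333_def using prob_edges_all_3[OF q] sub2 c3 by simp_all
  have "triangle333 S \<inter> triangle333 T = {\<Gamma>. \<forall>e\<in>nsets S 2 \<union> nsets T 2. \<Gamma> e = Some 3}"
    by (auto simp: triangle333_def)
  then have PST: "P (triangle333 S \<inter> triangle333 T) = q 3 ^ card (nsets S 2 \<union> nsets T 2)"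
    unfolding P_def using prob_edges_all_3[OF q, of "nsets S 2 \<union> nsets T 2"] sub2 by simp
  have "card (nsets S 2 \<union> nsets T 2) + (card (S \<inter> T) choose 2) = 6"
    using card_Un_Int[of "nsets S 2" "nsets T 2"] c3 fin
    by (simp add: finite_imp_finite_nsets card_nsets_choose flip: nsets_Int)
  then have cU: "card (nsets S 2 \<union> nsets T 2) = 6 - (card (S \<inter> T) choose 2)" by simp
  have "card (S \<inter> T) \<le> 3"
    using card_mono[of S "S \<inter> T"] fin card by auto
  then consider "card (S \<inter> T) \<le> 1" | "card (S \<inter> T) = 2" | "card (S \<inter> T) = 3" by linarith
  then show ?thesis
  proof cases
    case 1
    then have "card (S \<inter> T) choose 2 = 0" and "S \<noteq> T" using card by auto
    with 1 show ?thesis by (simp only: PS PST cU) (simp flip: power_add)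
  next
    case 2
    then have "S \<noteq> T" using card by auto
    with 2 nonneg show ?thesis by (simp add: PS PST cU)
  next
    case 3
    then have "S \<inter> T = S" "S \<inter> T = T"
      using fin card by (metis card_subset_eq inf_le1, metis card_subset_eq inf_le2)
    then have "S = T" by simp
    with 3 nonneg show ?thesis by (simp add: PS PST cU choose_two)
  qed
qed

text \<open>Such a \<open>T\<close> arises from \<open>S\<close> by exchanging one element for a new one.\<close>

lemma card_sets_sharing_all_but_one_le:
  assumes "S \<in> nsets {..<n} (Suc k)"
  shows "card {T \<in> nsets {..<n} (Suc k). card (S \<inter> T) = k} \<le> Suc k * n"
proof -
  have S: "finite S" "card S = Suc k" using assms by (auto simp: nsets_def)
  have "{T \<in> nsets {..<n} (Suc k). card (S \<inter> T) = k} \<subseteq> (\<lambda>(y, x). insert x (S - {y})) ` (S \<times> {..<n})"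
  proof
    fix T assume "T \<in> {T \<in> nsets {..<n} (Suc k). card (S \<inter> T) = k}"
    then have T: "finite T" "card T = Suc k" "T \<subseteq> {..<n}" and ST: "card (S \<inter> T) = k"
      by (auto simp: nsets_def)
    have "card (S - T) = 1" "card (T - S) = 1"
      using S T ST by (simp_all add: card_Diff_subset_Int Int_commute)
    then obtain x y where y: "S - T = {y}" and x: "T - S = {x}"
      by (meson card_1_singletonE)
    have "T = insert x (S - {y})" using x y by blast
    moreover have "(y, x) \<in> S \<times> {..<n}" using x y T(3) by auto
    ultimately show "T \<in> (\<lambda>(y, x). insert x (S - {y})) ` (S \<times> {..<n})"
      by (force simp: image_iff)
  qed
  then have "card {T \<in> nsets {..<n} (Suc k). card (S \<inter> T) = k} \<le> card (S \<times> {..<n})"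
    using S by (intro surj_card_le) auto
  then show ?thesis using S by simp
qed

text \<open>
  The two summands come from the diagonal of the variance and from the pairs of triangles with a
  common edge. The constants come from the bound \<open>n choose 3 \<ge> (n / 3)\<^sup>3\<close>.
\<close>

lemma prob_no_triangle333_le:
  assumes q: "label_weights q" and pos: "0 < q 3" and n: "3 \<le> n"
  shows "measure_pmf.prob (random_labelled_graph n q) (- (\<Union>T\<in>nsets {..<n} 3. triangle333 T))
    \<le> 27 / (real n * q 3) ^ 3 + 81 / (real n * (real n * q 3))"
proof -
  define M where "M = random_labelled_graph n q"
  let ?P = "measure_pmf.prob M"
  let ?I = "nsets {..<n} 3"
  define N where "N = real (card ?I)"
  have fin: "finite ?I" by (simp add: finite_imp_finite_nsets)
  have N: "(real n / 3) ^ 3 \<le> N"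
    using binomial_ge_n_over_k_pow_k[OF n, where ?'a = real]
    by (simp add: N_def card_nsets_choose)
  have N0: "0 < N" by (rule less_le_trans[OF _ N]) (use n in simp)
  have single: "?P (triangle333 T) = q 3 ^ 3" if "T \<in> ?I" for T
  proof -
    have "card (nsets T 2) = 3" "nsets T 2 \<subseteq> nsets {..<n} 2"
      using that by (auto simp: nsets_def[of _ 3] card_nsets_choose choose_two
        intro: nsets_mono[THEN subsetD])
    then show ?thesis
      using prob_edges_all_3[OF q, of "nsets T 2" n] by (simp add: M_def triangle333_def)
  qed
  then have mean: "(\<Sum>T\<in>?I. ?P (triangle333 T)) = N * q 3 ^ 3"
    by (simp add: N_def)
  have "(\<Sum>S\<in>?I. \<Sum>T\<in>?I. ?P (triangle333 S \<inter> triangle333 T)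
        - ?P (triangle333 S) * ?P (triangle333 T))
      \<le> (\<Sum>S\<in>?I. q 3 ^ 3 + 3 * real n * q 3 ^ 5)"
  proof (rule sum_mono)
    fix S assume S: "S \<in> ?I"
    have "(\<Sum>T\<in>?I. ?P (triangle333 S \<inter> triangle333 T) - ?P (triangle333 S) * ?P (triangle333 T))
      \<le> (\<Sum>T\<in>?I. (if S = T then q 3 ^ 3 else 0) + (if card (S \<inter> T) = 2 then q 3 ^ 5 else 0))"
      unfolding M_def by (intro sum_mono covariance_triangle333 q S)
    also have "\<dots> = q 3 ^ 3 + real (card {T \<in> ?I. card (S \<inter> T) = 2}) * q 3 ^ 5"
      using fin S by (simp add: sum.distrib sum.If_cases Int_def)
    also have "card {T \<in> ?I. card (S \<inter> T) = 2} \<le> 3 * n"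
      using card_sets_sharing_all_but_one_le[of S n 2] S by simp
    then have "real (card {T \<in> ?I. card (S \<inter> T) = 2}) * q 3 ^ 5 \<le> 3 * real n * q 3 ^ 5"
      using pos by (intro mult_right_mono) (simp_all flip: of_nat_le_iff[where ?'a = real])
    finally show "(\<Sum>T\<in>?I. ?P (triangle333 S \<inter> triangle333 T)
        - ?P (triangle333 S) * ?P (triangle333 T)) \<le> q 3 ^ 3 + 3 * real n * q 3 ^ 5"
      by simp
  qed
  also have "\<dots> = N * (q 3 ^ 3 + 3 * real n * q 3 ^ 5)"
    by (simp add: N_def)
  finally have cov: "(\<Sum>S\<in>?I. \<Sum>T\<in>?I. ?P (triangle333 S \<inter> triangle333 T)
        - ?P (triangle333 S) * ?P (triangle333 T)) \<le> N * (q 3 ^ 3 + 3 * real n * q 3 ^ 5)" .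
  have "?P (- (\<Union>T\<in>?I. triangle333 T)) \<le> N * (q 3 ^ 3 + 3 * real n * q 3 ^ 5) / (N * q 3 ^ 3)\<^sup>2"
    using measure_pmf.prob_none_le_second_moment[OF fin, of triangle333 M] N0 pos
      divide_right_mono[OF cov, of "(N * q 3 ^ 3)\<^sup>2"]
    by (simp add: mean Compl_eq_Diff_UNIV)
  also have "\<dots> = (1 / q 3 ^ 3 + 3 * real n / q 3) / N"
    using N0 pos by (simp add: field_simps eval_nat_numeral)
  also have "\<dots> \<le> (1 / q 3 ^ 3 + 3 * real n / q 3) / (real n / 3) ^ 3"
    using N pos n by (intro divide_left_mono) (auto intro!: mult_pos_pos N0 add_nonneg_nonneg)
  also have "\<dots> = 27 / (real n * q 3) ^ 3 + 81 / (real n * (real n * q 3))"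
    using pos n by (simp add: field_simps eval_nat_numeral)
  finally show ?thesis by (simp add: M_def)
qed

theorem theorem13:
  fixes p :: "nat \<Rightarrow> nat \<Rightarrow> real"
  assumes "\<And>n. label_weights (\<lambda>m. p m n)"
    and "filterlim (\<lambda>n. real n * p 3 n) at_top sequentially"
  shows "(\<lambda>n. measure_pmf.prob (random_labelled_graph n (\<lambda>m. p m n))
            {\<Gamma>. \<not> FC_type {..<n} \<Gamma>}) \<longlonglongrightarrow> 1"
proof -
  define x where "x n = real n * p 3 n" for n
  have x: "filterlim x at_top sequentially"
    using assms(2) by (simp add: x_def[abs_def])
  have lower: "\<forall>\<^sub>F n in sequentially. 1 - (27 / x n ^ 3 + 81 / (real n * x n))
      \<le> measure_pmf.prob (random_labelled_graph n (\<lambda>m. p m n)) {\<Gamma>. \<not> FC_type {..<n} \<Gamma>}"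
    using eventually_ge_at_top[of 3] filterlim_at_top_dense[THEN iffD1, OF x, rule_format, of 0]
  proof eventually_elim
    case (elim n)
    let ?M = "random_labelled_graph n (\<lambda>m. p m n)"
    let ?A = "\<Union>T\<in>nsets {..<n} 3. triangle333 T :: nat labelled_graph set"
    have "p 3 n > 0"
      using elim by (simp add: x_def zero_less_mult_iff)
    then have "1 - (27 / x n ^ 3 + 81 / (real n * x n)) \<le> 1 - measure_pmf.prob ?M (- ?A)"
      using prob_no_triangle333_le[OF assms(1), of n n] elim(1) by (simp add: x_def)
    also have "\<dots> = measure_pmf.prob ?M ?A"
      using measure_pmf.prob_compl[of ?A ?M] by (simp add: Compl_eq_Diff_UNIV)
    also have "\<dots> \<le> measure_pmf.prob ?M {\<Gamma>. \<not> FC_type {..<n} \<Gamma>}"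
    proof (rule measure_pmf.finite_measure_mono_AE)
      have "\<not> FC_type {..<n} \<Gamma>" if "\<Gamma> \<in> set_pmf ?M" "T \<in> nsets {..<n} 3" "\<Gamma> \<in> triangle333 T" for \<Gamma> T
        using random_graph_no_label_1[OF assms(1) that(1)] that(2,3)
        by (rule not_FC_type_of_triangle333)
      then show "AE \<Gamma> in ?M. \<Gamma> \<in> ?A \<longrightarrow> \<Gamma> \<in> {\<Gamma>. \<not> FC_type {..<n} \<Gamma>}"
        by (auto simp: AE_measure_pmf_iff)
    qed simp
    finally show ?case .
  qed
  have "(\<lambda>n. 27 / x n ^ 3) \<longlonglongrightarrow> 0"
    by (intro tendsto_divide_0[OF tendsto_const] filterlim_at_top_imp_at_infinity
        filterlim_pow_at_top x) simp
  moreover have "(\<lambda>n. 81 / (real n * x n)) \<longlonglongrightarrow> 0"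
    by (intro tendsto_divide_0[OF tendsto_const] filterlim_at_top_imp_at_infinity
        filterlim_at_top_mult_at_top filterlim_real_sequentially x)
  ultimately have "(\<lambda>n. 1 - (27 / x n ^ 3 + 81 / (real n * x n))) \<longlonglongrightarrow> 1 - (0 + 0)"
    by (intro tendsto_intros)
  then show ?thesis
    by (intro tendsto_sandwich[OF lower, where h = "\<lambda>_. 1"]) simp_all
qed

end
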